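(* Let $A\in\mathbb{Z}^{m\times n}$, $b\in\mathbb{Z}^m$, $l,u\in\mathbb{Z}^n$, and let $f:\mathbb{R}^n\to\mathbb{R}$ be separable convex. Let $\hat x$ be an optimum of the relaxation $$\min\{f(x)\mid Ax=b,\ l\le x\le u,\ x\in\mathbb{R}^n\}\qquad\text{(P)}$$ and let $\hat z$ be an optimum of $$\min\{f(x)\mid Ax=b,\ l\le x\le u,\ x\in\mathbb{Z}^n\}.\qquad\text{(IP)}$$ Then there exist $x^*\in\mathbb{R}^n$ and $z^*\in\mathbb{Z}^n$, optima of (P) and (IP), respectively, such that $$\|\hat x-z^*\|_\infty=\|x^*-\hat z\|_\infty\le n\,g_\infty(A),\qquad \|\hat x-z^*\|_1=\|x^*-\hat z\|_1\le n\,g_1(A).$$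
   Context: $f$ is separable convex if $f(x)=\sum_{i=1}^n f_i(x_i)$ with each $f_i$ convex. For $x,y\in\mathbb{R}^n$ write $x\sqsubseteq y$ if $x_iy_i\ge0$ and $|x_i|\le|y_i|$ for all $i$. The Graver basis $\mathcal{G}(A)$ is the (finite) set of $\sqsubseteq$-minimal elements of $\{x\in\mathbb{Z}^n\mid Ax=\mathbf{0}\}\setminus\{\mathbf{0}\}$; $g_\infty(A):=\max_{g\in\mathcal{G}(A)}\|g\|_\infty$ and $g_1(A):=\max_{g\in\mathcal{G}(A)}\|g\|_1$ (interpreted as $0$ if $\mathcal{G}(A)=\emptyset$). *)

theory Defs
  imports "HOL-Analysis.Analysis"
begin

definition real_vec :: "int ^ 'n \<Rightarrow> real ^ 'n"
  where "real_vec z = (\<chi> i. real_of_int (z $ i))"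

definition l1norm :: "real ^ 'n \<Rightarrow> real"
  where "l1norm x = (\<Sum>i\<in>UNIV. \<bar>x $ i\<bar>)"

definition separable_convex :: "(real ^ 'n \<Rightarrow> real) \<Rightarrow> bool"
  where "separable_convex f \<longleftrightarrow>
    (\<exists>fi :: 'n \<Rightarrow> real \<Rightarrow> real. (\<forall>i. convex_on UNIV (fi i)) \<and> (\<forall>x. f x = (\<Sum>i\<in>UNIV. fi i (x $ i))))"

(* Polymorphic, so that it applies to real vectors and to integer vectors alike. *)
definition conformal_le :: "'a::linordered_idom ^ 'n \<Rightarrow> 'a ^ 'n \<Rightarrow> bool"  (infix "\<sqsubseteq>" 50)
  where "x \<sqsubseteq> y \<longleftrightarrow> (\<forall>i. 0 \<le> x $ i * y $ i \<and> \<bar>x $ i\<bar> \<le> \<bar>y $ i\<bar>)"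

definition graver_basis :: "int ^ 'n ^ 'm \<Rightarrow> (int ^ 'n) set"
  where "graver_basis A =
    (let K = {x. A *v x = 0} - {0} in {g \<in> K. \<forall>x\<in>K. x \<sqsubseteq> g \<longrightarrow> x = g})"

(* Max is meaningful here because the Graver basis is always finite (Gordan-Dickson). *)
definition graver_inf :: "int ^ 'n ^ 'm \<Rightarrow> real"
  where "graver_inf A =
    (if graver_basis A = {} then 0 else Max ((\<lambda>g. infnorm (real_vec g)) ` graver_basis A))"

definition graver_l1 :: "int ^ 'n ^ 'm \<Rightarrow> real"
  where "graver_l1 A =
    (if graver_basis A = {} then 0 else Max ((\<lambda>g. l1norm (real_vec g)) ` graver_basis A))"

(* The order on vectors is the componentwise one. *)
definition real_feasible :: "int ^ 'n ^ 'm \<Rightarrow> int ^ 'm \<Rightarrow> int ^ 'n \<Rightarrow> int ^ 'n \<Rightarrow> real ^ 'n \<Rightarrow> bool"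
  where "real_feasible A b l u x \<longleftrightarrow>
    map_matrix real_of_int A *v x = real_vec b \<and> real_vec l \<le> x \<and> x \<le> real_vec u"

definition int_feasible :: "int ^ 'n ^ 'm \<Rightarrow> int ^ 'm \<Rightarrow> int ^ 'n \<Rightarrow> int ^ 'n \<Rightarrow> int ^ 'n \<Rightarrow> bool"
  where "int_feasible A b l u z \<longleftrightarrow> A *v z = b \<and> l \<le> z \<and> z \<le> u"

definition real_optimum ::
    "(real ^ 'n \<Rightarrow> real) \<Rightarrow> int ^ 'n ^ 'm \<Rightarrow> int ^ 'm \<Rightarrow> int ^ 'n \<Rightarrow> int ^ 'n \<Rightarrow> real ^ 'n \<Rightarrow> bool"
  where "real_optimum f A b l u x \<longleftrightarrow> is_arg_min f (real_feasible A b l u) x"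

definition int_optimum ::
    "(real ^ 'n \<Rightarrow> real) \<Rightarrow> int ^ 'n ^ 'm \<Rightarrow> int ^ 'm \<Rightarrow> int ^ 'n \<Rightarrow> int ^ 'n \<Rightarrow> int ^ 'n \<Rightarrow> bool"
  where "int_optimum f A b l u z \<longleftrightarrow> is_arg_min (\<lambda>z. f (real_vec z)) (int_feasible A b l u) z"

end

theory Submission
  imports Defs
begin

text \<open>
  The difference \<open>x = x_hat - z_hat\<close> lies in the real kernel of \<open>A\<close>. Simultaneous Diophantine
  approximation of \<open>x\<close> produces an integral kernel vector with the sign pattern of \<open>x\<close>, and below
  it a Graver element \<open>g\<close>. Subtracting from \<open>x\<close> the largest multiple of \<open>g\<close> that is conformal to
  \<open>x\<close> kills a coordinate, so \<open>x\<close> is a conformal nonnegative combination of at most \<open>n\<close> Graver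
  elements. Let \<open>y\<close> be the same combination with all coefficients rounded down. By conformality
  \<open>x_hat - y\<close> and \<open>z_hat + y\<close> stay in the box, and separable convexity gives
  \<open>f (x_hat - y) + f (z_hat + y) \<le> f x_hat + f z_hat\<close>, so both are optimal. The two distances in
  question are both the norm of \<open>x - y\<close>, a combination with \<open>n\<close> coefficients in \<open>[0,1]\<close>.
\<close>

section \<open>Integer vectors as real vectors, and the l1 norm\<close>

lemma real_vec_nth [simp]: "real_vec z $ i = real_of_int (z $ i)"
  by (simp add: real_vec_def)

lemma real_vec_add: "real_vec (y + z) = real_vec y + real_vec z"
  by (simp add: vec_eq_iff)

lemma map_matrix_mult_real_vec:
  "map_matrix real_of_int A *v real_vec z = real_vec (A *v z)"
  by (simp add: vec_eq_iff matrix_vector_mult_def)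

lemma l1norm_nonneg: "0 \<le> l1norm x"
  by (simp add: l1norm_def sum_nonneg)

lemma l1norm_triangle: "l1norm (x + y) \<le> l1norm x + l1norm y"
  unfolding l1norm_def sum.distrib[symmetric] by (intro sum_mono) (simp add: abs_triangle_ineq)

lemma l1norm_scaleR: "l1norm (c *\<^sub>R x) = \<bar>c\<bar> * l1norm x"
  by (simp add: l1norm_def abs_mult sum_distrib_left)

subsection \<open>Finiteness of the Graver basis\<close>

lemma decseq_nat_eventually_const:
  fixes X :: "nat \<Rightarrow> nat"
  assumes "decseq X"
  shows "\<exists>N. \<forall>n\<ge>N. X n = X N"
proof -
  define m where "m = (LEAST m. m \<in> range X)"
  have "m \<in> range X"
    unfolding m_def by (rule LeastI[of _ "X 0"]) simp
  then obtain N where N: "X N = m" by auto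
  have "X n = X N" if "n \<ge> N" for n
  proof (rule antisym)
    show "X n \<le> X N" using assms that by (simp add: decseq_def)
    show "X N \<le> X n" unfolding N m_def by (rule Least_le) simp
  qed
  then show ?thesis by blast
qed

text \<open>Every sequence has a monotone subsequence; a decreasing one in the naturals is
  eventually constant, so a tail of it is increasing.\<close>

lemma nat_seq_incseq_subseq:
  fixes X :: "nat \<Rightarrow> nat"
  shows "\<exists>r. strict_mono r \<and> incseq (\<lambda>k. X (r k))"
proof -
  obtain r where r: "strict_mono r" "monoseq (\<lambda>k. X (r k))"
    using seq_monosub by blast
  from r(2) consider "incseq (\<lambda>k. X (r k))" | "decseq (\<lambda>k. X (r k))"
    unfolding monoseq_iff by blast
  then show ?thesis
  proof cases
    case 2
    then obtain N where N: "\<forall>n\<ge>N. X (r n) = X (r N)"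
      using decseq_nat_eventually_const[of "\<lambda>k. X (r k)"] by blast
    have "strict_mono (\<lambda>k. r (k + N))" using r(1) by (simp add: strict_mono_def)
    moreover have "incseq (\<lambda>k. X (r (k + N)))"
      unfolding incseq_def using N by (metis le_add2 order_refl)
    ultimately show ?thesis by blast
  qed (use r in blast)
qed

text \<open>Dickson's lemma for sequences. The subsequence is thinned once per coordinate, and
  monotonicity in the earlier coordinates survives further thinning.\<close>

lemma dickson_subseq:
  fixes h :: "nat \<Rightarrow> 'i \<Rightarrow> nat"
  assumes "finite I"
  shows "\<exists>r. strict_mono r \<and> (\<forall>i\<in>I. incseq (\<lambda>k. h (r k) i))"
  using assms
proof (induction I)
  case empty
  show ?case using strict_mono_id by auto
next
  case (insert j I)
  then obtain r where r: "strict_mono r" "\<forall>i\<in>I. incseq (\<lambda>k. h (r k) i)" by blast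
  obtain s where s: "strict_mono s" "incseq (\<lambda>k. h (r (s k)) j)"
    using nat_seq_incseq_subseq[of "\<lambda>k. h (r k) j"] by blast
  have "strict_mono (r \<circ> s)" using r(1) s(1) by (rule strict_mono_o)
  moreover have "incseq (\<lambda>k. h ((r \<circ> s) k) i)" if "i \<in> I" for i
    using r(2) that s(1) by (auto simp: incseq_def strict_mono_less_eq)
  ultimately show ?case using s(2) by (intro exI[of _ "r \<circ> s"]) (simp add: comp_def)
qed

text \<open>Distinct Graver elements are incomparable by minimality, whereas Dickson's lemma finds
  two comparable members in any infinite sequence.\<close>

lemma finite_graver_basis: "finite (graver_basis A)"
proof (rule ccontr)
  assume "infinite (graver_basis A)"
  then obtain g :: "nat \<Rightarrow> int ^ 'a" where g: "inj g" "range g \<subseteq> graver_basis A"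
    using infinite_countable_subset by blast
  \<comment> \<open>Splitting into positive and negative parts turns conformality into the order on \<open>nat\<close>.\<close>
  define h where "h k = (\<lambda>(i, s). nat (if s then g k $ i else - (g k $ i)))" for k
  obtain r where r: "strict_mono r" "\<forall>p\<in>UNIV. incseq (\<lambda>k. h (r k) p)"
    using dickson_subseq[of "UNIV :: ('a \<times> bool) set" h] by auto
  have "g (r 0) \<sqsubseteq> g (r 1)"
    unfolding conformal_le_def
  proof
    fix i
    have "h (r 0) (i, True) \<le> h (r 1) (i, True)" "h (r 0) (i, False) \<le> h (r 1) (i, False)"
      using r(2) by (auto simp: incseq_def)
    then have "nat (g (r 0) $ i) \<le> nat (g (r 1) $ i)" "nat (- (g (r 0) $ i)) \<le> nat (- (g (r 1) $ i))"
      by (auto simp: h_def)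
    then show "0 \<le> g (r 0) $ i * g (r 1) $ i \<and> \<bar>g (r 0) $ i\<bar> \<le> \<bar>g (r 1) $ i\<bar>"
      by (auto simp: zero_le_mult_iff)
  qed
  moreover have "g (r 0) \<in> graver_basis A" "g (r 1) \<in> graver_basis A" using g(2) by auto
  ultimately have "g (r 0) = g (r 1)" by (auto simp: graver_basis_def Let_def)
  then have "r 0 = r 1" using g(1) by (simp add: inj_eq)
  then show False using r(1) by (simp add: strict_mono_eq)
qed

lemma graver_inf_ge: "g \<in> graver_basis A \<Longrightarrow> infnorm (real_vec g) \<le> graver_inf A"
  unfolding graver_inf_def using finite_graver_basis[of A] by (subst if_not_P) (auto intro: Max_ge)

lemma graver_l1_ge: "g \<in> graver_basis A \<Longrightarrow> l1norm (real_vec g) \<le> graver_l1 A"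
  unfolding graver_l1_def using finite_graver_basis[of A] by (subst if_not_P) (auto intro: Max_ge)

lemma graver_inf_nonneg: "0 \<le> graver_inf A"
proof (cases "graver_basis A = {}")
  case False
  then show ?thesis using graver_inf_ge infnorm_pos_le order_trans by blast
qed (simp add: graver_inf_def)

lemma graver_l1_nonneg: "0 \<le> graver_l1 A"
proof (cases "graver_basis A = {}")
  case False
  then show ?thesis using graver_l1_ge l1norm_nonneg order_trans by blast
qed (simp add: graver_l1_def)

subsection \<open>Conformal decomposition\<close>

lemma conformal_le_trans:
  fixes x y z :: "'a::linordered_idom ^ 'n"
  assumes "x \<sqsubseteq> y" "y \<sqsubseteq> z"
  shows "x \<sqsubseteq> z"
  unfolding conformal_le_def
proof
  fix i
  have "0 \<le> x $ i * y $ i \<and> \<bar>x $ i\<bar> \<le> \<bar>y $ i\<bar>" "0 \<le> y $ i * z $ i \<and> \<bar>y $ i\<bar> \<le> \<bar>z $ i\<bar>"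
    using assms by (auto simp: conformal_le_def)
  then show "0 \<le> x $ i * z $ i \<and> \<bar>x $ i\<bar> \<le> \<bar>z $ i\<bar>"
    by (auto simp: zero_le_mult_iff)
qed

text \<open>Descent on the l1 norm: a kernel vector that is not minimal has a nonzero kernel vector
  of smaller norm below it.\<close>

lemma graver_below:
  fixes A :: "int ^ 'n ^ 'm"
  assumes "A *v y = 0" "y \<noteq> 0"
  shows "\<exists>g\<in>graver_basis A. g \<sqsubseteq> y"
  using assms
proof (induction "\<Sum>i\<in>UNIV. nat \<bar>y $ i\<bar>" arbitrary: y rule: less_induct)
  case less
  show ?case
  proof (cases "y \<in> graver_basis A")
    case True
    then show ?thesis by (auto simp: conformal_le_def intro!: bexI[of _ y])
  next
    case False
    then obtain x where x: "A *v x = 0" "x \<noteq> 0" "x \<sqsubseteq> y" "x \<noteq> y"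
      using less.prems by (auto simp: graver_basis_def Let_def)
    obtain j where j: "x $ j \<noteq> y $ j" using x(4) by (auto simp: vec_eq_iff)
    have le: "\<bar>x $ i\<bar> \<le> \<bar>y $ i\<bar>" "0 \<le> x $ i * y $ i" for i
      using x(3) by (auto simp: conformal_le_def)
    \<comment> \<open>With compatible signs, equal absolute values would force equal
      entries.\<close>
    have "\<bar>x $ j\<bar> < \<bar>y $ j\<bar>"
      using le[of j] j by (auto simp: zero_le_mult_iff)
    then have "(\<Sum>i\<in>UNIV. nat \<bar>x $ i\<bar>) < (\<Sum>i\<in>UNIV. nat \<bar>y $ i\<bar>)"
      using le by (intro sum_strict_mono_ex1) (auto intro!: exI[of _ j] nat_mono)
    then obtain g where "g \<in> graver_basis A" "g \<sqsubseteq> x" using less.hyps x by blast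
    then show ?thesis using x(3) conformal_le_trans by blast
  qed
qed

section \<open>Integral kernel vectors from Diophantine approximation\<close>

lemma dirichlet_vec:
  fixes x :: "real ^ 'n"
  assumes "N > 0"
  obtains q :: int and p :: "int ^ 'n"
  where "q > 0" "\<And>i. \<bar>of_int q * x $ i - of_int (p $ i)\<bar> < 1 / real N"
proof -
  \<comment> \<open>\<open>Dirichlet_approx_simult\<close> indexes the reals by natural numbers, so
    \<open>e\<close> numbers the coordinates.\<close>
  obtain e where e: "bij_betw e (UNIV :: 'n set) {0..<CARD('n)}"
    using ex_bij_betw_finite_nat[of "UNIV :: 'n set"] by auto
  define \<theta> where "\<theta> k = x $ (inv e k)" for k
  obtain q p where qp: "0 < q" "\<And>k. k < CARD('n) \<Longrightarrow> \<bar>of_int q * \<theta> k - of_int (p k)\<bar> < 1 / real N"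
    using Dirichlet_approx_simult[OF assms, where n = "CARD('n)" and \<theta> = \<theta>] by metis
  have "inj e" using e by (simp add: bij_betw_def)
  then have \<theta>: "\<theta> (e i) = x $ i" for i by (simp add: \<theta>_def)
  have "e i < CARD('n)" for i using bij_betwE[OF e] by auto
  then have "\<bar>of_int q * x $ i - of_int ((\<chi> i. p (e i)) $ i)\<bar> < 1 / real N" for i
    using qp(2)[of "e i"] \<theta> by simp
  then show ?thesis using qp(1) that by blast
qed

text \<open>The witness is a simultaneous approximation of a multiple \<open>q * x\<close>, so close
  that no sign can flip and that integrality removes the remaining error.\<close>

lemma real_kernel_sign_compatible_int:
  fixes A :: "int ^ 'n ^ 'm" and x :: "real ^ 'n"
  assumes "map_matrix real_of_int A *v x = 0" "x \<noteq> 0"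
  obtains y where "A *v y = 0" "y \<noteq> 0" "\<And>i. 0 \<le> of_int (y $ i) * x $ i" "\<And>i. x $ i = 0 \<Longrightarrow> y $ i = 0"
proof -
  \<comment> \<open>The value 1 at zero coordinates keeps \<open>\<epsilon>\<close> positive without
    spoiling the bound at the nonzero ones.\<close>
  define \<epsilon> where "\<epsilon> = Min ((\<lambda>i. if x $ i = 0 then 1 else \<bar>x $ i\<bar>) ` UNIV)"
  have \<epsilon>_pos: "\<epsilon> > 0" unfolding \<epsilon>_def by (subst Min_gr_iff) auto
  have \<epsilon>_le: "\<epsilon> \<le> \<bar>x $ i\<bar>" if "x $ i \<noteq> 0" for i
  proof -
    have "\<epsilon> \<le> (if x $ i = 0 then 1 else \<bar>x $ i\<bar>)"
      unfolding \<epsilon>_def by (rule Min_le) auto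
    then show ?thesis using that by simp
  qed
  \<comment> \<open>\<open>M\<close> dominates the l1 norm of every row of \<open>A\<close>. Taking
    \<open>N\<close> above \<open>M\<close> and \<open>1 / \<epsilon>\<close> makes the error small
    enough both for the kernel equation and for the signs.\<close>
  define M where "M = (\<Sum>j\<in>UNIV. \<Sum>i\<in>UNIV. \<bar>real_of_int (A $ j $ i)\<bar>)"
  obtain N0 :: nat where N0: "real N0 > max (1 / \<epsilon>) M" using reals_Archimedean2 by blast
  define N where "N = Suc N0"
  have N: "N > 0" "1 / \<epsilon> < N" "M < N" using N0 by (auto simp: N_def)
  have N\<epsilon>: "1 / real N < \<epsilon>" using N \<epsilon>_pos by (simp add: field_simps)
  obtain q :: int and p :: "int ^ 'n"
    where q: "q > 0" and p: "\<And>i. \<bar>of_int q * x $ i - of_int (p $ i)\<bar> < 1 / real N"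
    using dirichlet_vec[OF N(1)] by blast
  have p': "\<bar>of_int (p $ i) - of_int q * x $ i\<bar> < \<epsilon>" for i
    using p[of i] N\<epsilon> by linarith
  \<comment> \<open>Since \<open>q\<close> is at least 1, \<open>q * x $ i\<close> has absolute
    value at least \<open>\<epsilon>\<close>, which exceeds the error, so \<open>p $ i\<close> takes
    its sign.\<close>
  have sign: "0 < of_int (p $ i) * x $ i" if "x $ i \<noteq> 0" for i
  proof -
    have "\<epsilon> \<le> of_int q * \<bar>x $ i\<bar>"
    proof -
      have "1 * \<bar>x $ i\<bar> \<le> of_int q * \<bar>x $ i\<bar>" using q by (intro mult_right_mono) auto
      then show ?thesis using \<epsilon>_le[OF that] by simp
    qed
    then show ?thesis using p'[of i] that by (cases "x $ i > 0") (auto simp: zero_less_mult_iff)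
  qed
  have zero: "p $ i = 0" if "x $ i = 0" for i
  proof -
    have "1 / real N \<le> 1" using N(1) by simp
    then have "\<bar>real_of_int (p $ i)\<bar> < 1" using p[of i] that by simp
    then show ?thesis by linarith
  qed
  \<comment> \<open>\<open>A p = A (p - q x)\<close> is integral with all entries smaller than 1 in absolute value.\<close>
  have "(A *v p) $ j = 0" for j
  proof -
    have "(\<Sum>i\<in>UNIV. real_of_int (A $ j $ i) * x $ i) = 0"
      using assms(1) by (auto simp: vec_eq_iff matrix_vector_mult_def)
    then have "(\<Sum>i\<in>UNIV. of_int (A $ j $ i) * (of_int q * x $ i)) = 0"
      by (simp add: mult.left_commute flip: sum_distrib_left)
    then have "real_of_int ((A *v p) $ j) = (\<Sum>i\<in>UNIV. of_int (A $ j $ i) * (of_int (p $ i) - of_int q * x $ i))"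
      by (simp add: matrix_vector_mult_def right_diff_distrib sum_subtractf)
    also have "\<bar>\<dots>\<bar> \<le> (\<Sum>i\<in>UNIV. \<bar>real_of_int (A $ j $ i)\<bar> * (1 / N))"
    proof (rule order_trans[OF sum_abs sum_mono])
      fix i
      have "\<bar>of_int (p $ i) - of_int q * x $ i\<bar> \<le> 1 / N" using p[of i] by linarith
      then show "\<bar>of_int (A $ j $ i) * (of_int (p $ i) - of_int q * x $ i)\<bar> \<le> \<bar>real_of_int (A $ j $ i)\<bar> * (1 / N)"
        unfolding abs_mult by (rule mult_left_mono) simp
    qed
    also have "\<dots> = (\<Sum>i\<in>UNIV. \<bar>real_of_int (A $ j $ i)\<bar>) / N"
      by (simp add: sum_divide_distrib)
    also have "\<dots> \<le> M / N"
      unfolding M_def by (intro divide_right_mono member_le_sum) (auto simp: sum_nonneg)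
    also have "\<dots> < 1" using N by simp
    finally show ?thesis by linarith
  qed
  then have "A *v p = 0" by (simp add: vec_eq_iff)
  moreover have "p \<noteq> 0"
  proof -
    obtain i where "x $ i \<noteq> 0" using assms(2) by (auto simp: vec_eq_iff)
    then show ?thesis using sign[of i] by auto
  qed
  moreover have "0 \<le> of_int (p $ i) * x $ i" for i using sign[of i] by (cases "x $ i = 0") auto
  ultimately show ?thesis using zero that by blast
qed

text \<open>A Graver element below the sign-compatible vector inherits its signs and its
  zeros.\<close>

lemma real_kernel_graver:
  fixes A :: "int ^ 'n ^ 'm" and x :: "real ^ 'n"
  assumes "map_matrix real_of_int A *v x = 0" "x \<noteq> 0"
  obtains g where "g \<in> graver_basis A" "\<And>i. 0 \<le> of_int (g $ i) * x $ i" "\<And>i. x $ i = 0 \<Longrightarrow> g $ i = 0"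
proof -
  obtain y where y: "A *v y = 0" "y \<noteq> 0" "\<And>i. 0 \<le> of_int (y $ i) * x $ i" "\<And>i. x $ i = 0 \<Longrightarrow> y $ i = 0"
    using real_kernel_sign_compatible_int[OF assms] by blast
  obtain g where g: "g \<in> graver_basis A" "g \<sqsubseteq> y" using graver_below[OF y(1,2)] by blast
  have gy: "0 \<le> g $ i * y $ i" "\<bar>g $ i\<bar> \<le> \<bar>y $ i\<bar>" for i using g(2) by (auto simp: conformal_le_def)
  have "0 \<le> of_int (g $ i) * x $ i" for i
    using gy[of i] y(3)[of i] by (auto simp: zero_le_mult_iff)
  moreover have "g $ i = 0" if "x $ i = 0" for i using y(4)[OF that] gy(2)[of i] by simp
  ultimately show ?thesis using g(1) that by blast
qed

text \<open>Quantifying over the seminorm \<open>N\<close> inside lets one \<open>y\<close> serve both norms.\<close>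

lemma conformal_rounding:
  fixes A :: "int ^ 'n ^ 'm" and x :: "real ^ 'n"
  assumes "map_matrix real_of_int A *v x = 0"
  shows "\<exists>y. A *v y = 0 \<and> real_vec y \<sqsubseteq> x \<and>
    (\<forall>N B. (\<forall>v w. N (v + w) \<le> N v + N w) \<longrightarrow> (\<forall>c v. N (c *\<^sub>R v) = \<bar>c\<bar> * N v) \<longrightarrow> 0 \<le> B \<longrightarrow>
      (\<forall>g\<in>graver_basis A. N (real_vec g) \<le> B) \<longrightarrow>
      N (x - real_vec y) \<le> real (card {i. x $ i \<noteq> 0}) * B)"
  using assms
\<comment> \<open>Each Graver element removed shrinks the support and adds at most one
  \<open>B\<close> to the error.\<close>
proof (induction "card {i. x $ i \<noteq> 0}" arbitrary: x rule: less_induct)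
  case less
  show ?case
  proof (cases "x = 0")
    case True
    have z: "real_vec 0 = (0 :: real ^ 'n)" by (simp add: vec_eq_iff)
    \<comment> \<open>Homogeneity at scalar 0 gives \<open>N 0 = 0\<close>.\<close>
    have "N (x - real_vec 0) \<le> real (card {i. x $ i \<noteq> 0}) * B"
      if "\<forall>c v. N (c *\<^sub>R v) = \<bar>c\<bar> * N v" for N and B :: real
      unfolding True z using that[rule_format, of 0 0] by simp
    moreover have "A *v 0 = 0" "real_vec 0 \<sqsubseteq> x"
      by (simp_all add: z True conformal_le_def)
    ultimately show ?thesis by blast
  next
    case False
    obtain g where g: "g \<in> graver_basis A" and sg: "\<And>i. 0 \<le> of_int (g $ i) * x $ i"
      and zg: "\<And>i. x $ i = 0 \<Longrightarrow> g $ i = 0"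
      using real_kernel_graver[OF less.prems False] by blast
    have Ag: "A *v g = 0" and "g \<noteq> 0" using g by (auto simp: graver_basis_def Let_def)
    define S where "S = {i. g $ i \<noteq> 0}"
    have "S \<noteq> {}" using \<open>g \<noteq> 0\<close> by (auto simp: S_def vec_eq_iff)
    \<comment> \<open>Ratio test: \<open>t\<close> is the largest multiple of \<open>g\<close> that
      can be subtracted without changing a sign; the entry at the minimizing index becomes
      zero.\<close>
    define t where "t = Min ((\<lambda>i. x $ i / of_int (g $ i)) ` S)"
    have "t \<in> (\<lambda>i. x $ i / of_int (g $ i)) ` S"
      unfolding t_def using \<open>S \<noteq> {}\<close> by (intro Min_in) auto
    then obtain j where j: "j \<in> S" "t = x $ j / of_int (g $ j)" by blast
    have t_le: "t \<le> x $ i / of_int (g $ i)" if "g $ i \<noteq> 0" for i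
      unfolding t_def using that by (intro Min_le) (auto simp: S_def)
    have t_nonneg: "0 \<le> t" using sg[of j] j by (auto simp: zero_le_mult_iff zero_le_divide_iff)
    define x' where "x' = x - t *\<^sub>R real_vec g"
    have x'_nth: "x' $ i = x $ i - t * of_int (g $ i)" for i by (simp add: x'_def)
    have Ax': "map_matrix real_of_int A *v x' = 0"
    proof -
      have "real_vec (A *v g) = 0" using Ag by (simp add: vec_eq_iff)
      then show ?thesis
        using less.prems unfolding x'_def
        by (simp add: matrix_vector_mult_diff_distrib matrix_vector_mult_scaleR map_matrix_mult_real_vec)
    qed
    have supp: "{i. x' $ i \<noteq> 0} \<subset> {i. x $ i \<noteq> 0}"
    proof -
      have "x' $ j = 0" "x $ j \<noteq> 0" using j zg[of j] by (auto simp: x'_nth S_def)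
      moreover have "x' $ i = 0" if "x $ i = 0" for i using zg[OF that] that by (simp add: x'_nth)
      ultimately show ?thesis by blast
    qed
    then have card: "card {i. x' $ i \<noteq> 0} < card {i. x $ i \<noteq> 0}" by (simp add: psubset_card_mono)
    obtain y' where y': "A *v y' = 0" "real_vec y' \<sqsubseteq> x'"
      and bound: "\<And>N B. \<forall>v w. N (v + w) \<le> N v + N w \<Longrightarrow> \<forall>c v. N (c *\<^sub>R v) = \<bar>c\<bar> * N v \<Longrightarrow> 0 \<le> B \<Longrightarrow>
        \<forall>g\<in>graver_basis A. N (real_vec g) \<le> B \<Longrightarrow>
        N (x' - real_vec y') \<le> real (card {i. x' $ i \<noteq> 0}) * B"
      using less.hyps[OF card Ax'] by blast
    \<comment> \<open>Only the integral part of \<open>t\<close> enters \<open>y\<close>; the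
      multiple \<open>frac t\<close> of \<open>g\<close> stays in the error.\<close>
    define y where "y = y' + \<lfloor>t\<rfloor> *s g"
    have "A *v (\<lfloor>t\<rfloor> *s g) = \<lfloor>t\<rfloor> *s (A *v g)"
      by (simp add: vec_eq_iff matrix_vector_mult_def sum_distrib_left mult.left_commute)
    then have "A *v y = 0"
      by (simp add: y_def matrix_vector_right_distrib y'(1) Ag)
    moreover have "real_vec y \<sqsubseteq> x"
      unfolding conformal_le_def
    proof
      fix i
      define a b c where "a = x $ i" and "b = real_of_int (g $ i)" and "c = real_of_int (y' $ i)"
      have y_nth: "real_vec y $ i = c + of_int \<lfloor>t\<rfloor> * b" by (simp add: y_def b_def c_def)
      have c: "0 \<le> c * (a - t * b)" "\<bar>c\<bar> \<le> \<bar>a - t * b\<bar>"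
        using y'(2) by (auto simp: conformal_le_def x'_nth a_def b_def c_def)
      have k: "0 \<le> real_of_int \<lfloor>t\<rfloor>" "of_int \<lfloor>t\<rfloor> \<le> t" using t_nonneg by auto
      have ab: "0 \<le> b * a" using sg[of i] by (simp add: a_def b_def)
      \<comment> \<open>\<open>c\<close> lies between 0 and \<open>a - t * b\<close>, and the
        rounded multiple of \<open>b\<close> between 0 and \<open>t * b\<close>. All have the sign
        of \<open>a\<close>, so the sum lies between 0 and \<open>a\<close>.\<close>
      have "0 \<le> (c + of_int \<lfloor>t\<rfloor> * b) * a \<and> \<bar>c + of_int \<lfloor>t\<rfloor> * b\<bar> \<le> \<bar>a\<bar>"
      proof (cases b "0 :: real" rule: linorder_cases)
        case equal
        then show ?thesis using c by simp
      next
        case greater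
        then have "t * b \<le> a" using t_le[of i] by (simp add: a_def b_def field_simps)
        \<comment> \<open>If \<open>a = t * b\<close>, the product gives no sign, but the bound on
          \<open>\<bar>c\<bar>\<close> forces \<open>c = 0\<close>.\<close>
        moreover have "0 \<le> c" using c calculation by (cases "a = t * b") (auto simp: zero_le_mult_iff)
        moreover have "0 \<le> of_int \<lfloor>t\<rfloor> * b" "of_int \<lfloor>t\<rfloor> * b \<le> t * b"
          using greater k by (auto intro: mult_right_mono)
        ultimately have "0 \<le> c + of_int \<lfloor>t\<rfloor> * b" "c + of_int \<lfloor>t\<rfloor> * b \<le> a" "0 \<le> a"
          using c(2) by linarith+
        then show ?thesis by simp
      next
        case less
        then have "t * b \<ge> a" using t_le[of i] by (simp add: a_def b_def field_simps)
        moreover have "c \<le> 0" using c calculation by (cases "a = t * b") (auto simp: zero_le_mult_iff)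
        moreover have "of_int \<lfloor>t\<rfloor> * b \<le> 0" "of_int \<lfloor>t\<rfloor> * b \<ge> t * b"
          using less k by (auto intro: mult_right_mono_neg mult_nonneg_nonpos)
        ultimately have "c + of_int \<lfloor>t\<rfloor> * b \<le> 0" "a \<le> c + of_int \<lfloor>t\<rfloor> * b" "a \<le> 0"
          using c(2) by linarith+
        then show ?thesis by (simp add: mult_nonpos_nonpos)
      qed
      then show "0 \<le> real_vec y $ i * x $ i \<and> \<bar>real_vec y $ i\<bar> \<le> \<bar>x $ i\<bar>"
        unfolding y_nth a_def .
    qed
    moreover have "N (x - real_vec y) \<le> real (card {i. x $ i \<noteq> 0}) * B"
      if sub: "\<forall>v w. N (v + w) \<le> N v + N w" and hom: "\<forall>c v. N (c *\<^sub>R v) = \<bar>c\<bar> * N v"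
        and B: "0 \<le> B" "\<forall>g\<in>graver_basis A. N (real_vec g) \<le> B" for N B
    proof -
      have "x - real_vec y = (x' - real_vec y') + frac t *\<^sub>R real_vec g"
        by (simp add: vec_eq_iff x'_nth y_def frac_def algebra_simps)
      then have "N (x - real_vec y) \<le> N (x' - real_vec y') + N (frac t *\<^sub>R real_vec g)"
        using sub by simp
      also have "N (frac t *\<^sub>R real_vec g) = frac t * N (real_vec g)" using hom by simp
      also have "\<dots> \<le> frac t * B" using B g by (intro mult_left_mono) auto
      also have "\<dots> \<le> 1 * B" using B frac_lt_1[of t] by (intro mult_right_mono) auto
      also have "N (x' - real_vec y') \<le> real (card {i. x' $ i \<noteq> 0}) * B"
        using bound[OF sub hom B] .
      also have "real (card {i. x' $ i \<noteq> 0}) * B + 1 * B = real (Suc (card {i. x' $ i \<noteq> 0})) * B"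
        by (simp add: algebra_simps)
      also have "\<dots> \<le> real (card {i. x $ i \<noteq> 0}) * B"
        using card B by (intro mult_right_mono) auto
      finally show ?thesis by simp
    qed
    ultimately show ?thesis by blast
  qed
qed

subsection \<open>Exchange\<close>

text \<open>The points \<open>a + t\<close> and \<open>b - t\<close> are convex combinations of
  \<open>a\<close> and \<open>b\<close> with swapped weights, so adding the two convexity
  inequalities cancels the weights.\<close>

lemma convex_on_exchange:
  fixes \<phi> :: "real \<Rightarrow> real"
  assumes "convex_on UNIV \<phi>" and t: "0 \<le> t * (b - a)" "\<bar>t\<bar> \<le> \<bar>b - a\<bar>"
  shows "\<phi> (a + t) + \<phi> (b - t) \<le> \<phi> a + \<phi> b"
proof (cases "a = b")
  case False
  define s where "s = t / (b - a)"
  have "\<bar>s\<bar> \<le> 1" using False t by (simp add: s_def field_simps)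
  moreover have "0 \<le> s" using t by (auto simp: s_def zero_le_divide_iff zero_le_mult_iff)
  ultimately have s: "0 \<le> s" "s \<le> 1" by auto
  have "t = s * (b - a)" using False by (simp add: s_def)
  then have eq: "a + t = (1 - s) *\<^sub>R a + s *\<^sub>R b" "b - t = (1 - s) *\<^sub>R b + s *\<^sub>R a"
    by (auto simp: algebra_simps)
  have "\<phi> (a + t) \<le> (1 - s) * \<phi> a + s * \<phi> b" "\<phi> (b - t) \<le> (1 - s) * \<phi> b + s * \<phi> a"
    unfolding eq using convex_onD[OF assms(1) s] by auto
  then show ?thesis by (simp add: algebra_simps)
qed (use t in simp)

text \<open>Conformality is the one-dimensional exchange condition in every coordinate, with
  \<open>z $ i\<close>, \<open>x $ i\<close> as endpoints and \<open>y $ i\<close> as shift.\<close>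

lemma separable_convex_exchange:
  assumes "separable_convex f" "y \<sqsubseteq> x - z"
  shows "f (x - y) + f (z + y) \<le> f x + f z"
proof -
  obtain fi where fi: "\<And>i. convex_on UNIV (fi i)" "\<And>x. f x = (\<Sum>i\<in>UNIV. fi i (x $ i))"
    using assms(1) unfolding separable_convex_def by blast
  have "fi i ((z + y) $ i) + fi i ((x - y) $ i) \<le> fi i (z $ i) + fi i (x $ i)" for i
    using convex_on_exchange[OF fi(1)[of i], of "y $ i" "x $ i" "z $ i"] assms(2)
    by (simp add: conformal_le_def)
  then have "(\<Sum>i\<in>UNIV. fi i ((z + y) $ i) + fi i ((x - y) $ i)) \<le> (\<Sum>i\<in>UNIV. fi i (z $ i) + fi i (x $ i))"
    by (rule sum_mono)
  then show ?thesis
    unfolding fi(2) sum.distrib by (simp add: add.commute)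
qed

section \<open>Optimality and distance of the exchanged points\<close>

theorem theorem62:
  fixes A :: "int ^ 'n ^ 'm" and b :: "int ^ 'm" and l u :: "int ^ 'n"
    and f :: "real ^ 'n \<Rightarrow> real" and x_hat :: "real ^ 'n" and z_hat :: "int ^ 'n"
  assumes "separable_convex f"
    and "real_optimum f A b l u x_hat"
    and "int_optimum f A b l u z_hat"
  shows "\<exists>x_star z_star.
    real_optimum f A b l u x_star \<and> int_optimum f A b l u z_star \<and>
    infnorm (x_hat - real_vec z_star) = infnorm (x_star - real_vec z_hat) \<and>
    infnorm (x_star - real_vec z_hat) \<le> real CARD('n) * graver_inf A \<and>
    l1norm (x_hat - real_vec z_star) = l1norm (x_star - real_vec z_hat) \<and>
    l1norm (x_star - real_vec z_hat) \<le> real CARD('n) * graver_l1 A"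
proof -
  define x where "x = x_hat - real_vec z_hat"
  have xf: "real_feasible A b l u x_hat" and x_min: "\<And>v. real_feasible A b l u v \<Longrightarrow> f x_hat \<le> f v"
    using assms(2) by (auto simp: real_optimum_def is_arg_min_def not_less)
  have zf: "int_feasible A b l u z_hat"
    and z_min: "\<And>v. int_feasible A b l u v \<Longrightarrow> f (real_vec z_hat) \<le> f (real_vec v)"
    using assms(3) by (auto simp: int_optimum_def is_arg_min_def not_less)
  have Ax: "map_matrix real_of_int A *v x = 0"
    using xf zf unfolding x_def real_feasible_def int_feasible_def
    by (simp add: matrix_vector_mult_diff_distrib map_matrix_mult_real_vec)
  obtain y where y: "A *v y = 0" "real_vec y \<sqsubseteq> x"
    and bound: "\<And>N B. \<forall>v w. N (v + w) \<le> N v + N w \<Longrightarrow> \<forall>c v. N (c *\<^sub>R v) = \<bar>c\<bar> * N v \<Longrightarrow> 0 \<le> B \<Longrightarrow>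
      \<forall>g\<in>graver_basis A. N (real_vec g) \<le> B \<Longrightarrow>
      N (x - real_vec y) \<le> real (card {i. x $ i \<noteq> 0}) * B"
    using conformal_rounding[OF Ax] by blast
  define x_star where "x_star = x_hat - real_vec y"
  define z_star where "z_star = z_hat + y"
  have real_Ay: "map_matrix real_of_int A *v real_vec y = 0"
    by (simp add: map_matrix_mult_real_vec y(1) vec_eq_iff)
  \<comment> \<open>By conformality both new entries lie between \<open>x_hat $ i\<close> and
    \<open>z_hat $ i\<close>, hence within the bounds.\<close>
  have box: "l $ i \<le> x_star $ i \<and> x_star $ i \<le> u $ i \<and> l $ i \<le> z_star $ i \<and> z_star $ i \<le> u $ i" for i
  proof -
    have "real_of_int (l $ i) \<le> x_hat $ i \<and> x_hat $ i \<le> u $ i"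
      using xf by (simp add: real_feasible_def less_eq_vec_def)
    moreover have "l $ i \<le> z_hat $ i \<and> z_hat $ i \<le> u $ i"
      using zf by (simp add: int_feasible_def less_eq_vec_def)
    moreover have "0 \<le> y $ i * (x_hat $ i - z_hat $ i)" "\<bar>real_of_int (y $ i)\<bar> \<le> \<bar>x_hat $ i - z_hat $ i\<bar>"
      using y(2) by (auto simp: conformal_le_def x_def)
    ultimately have "l $ i \<le> x_star $ i \<and> x_star $ i \<le> u $ i \<and>
        real_of_int (l $ i) \<le> real_of_int (z_star $ i) \<and> real_of_int (z_star $ i) \<le> u $ i"
      by (auto simp: x_star_def z_star_def zero_le_mult_iff)
    then show ?thesis by simp
  qed
  have x_star_f: "real_feasible A b l u x_star"
    using xf box real_Ay
    by (simp add: real_feasible_def x_star_def less_eq_vec_def matrix_vector_mult_diff_distrib)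
  have z_star_f: "int_feasible A b l u z_star"
    using zf box y(1)
    by (simp add: int_feasible_def z_star_def less_eq_vec_def matrix_vector_right_distrib)
  have "f x_star + f (real_vec z_star) \<le> f x_hat + f (real_vec z_hat)"
    using separable_convex_exchange[OF assms(1), of "real_vec y" x_hat "real_vec z_hat"] y(2)
    by (simp add: x_def x_star_def z_star_def real_vec_add)
  \<comment> \<open>Neither summand can fall below its minimum, so the bound on the sum forces
    equality in both.\<close>
  then have eq: "f x_star = f x_hat" "f (real_vec z_star) = f (real_vec z_hat)"
    using x_min[OF x_star_f] z_min[OF z_star_f] by auto
  have "real_optimum f A b l u x_star" "int_optimum f A b l u z_star"
    using x_star_f z_star_f x_min z_min
    by (auto simp: real_optimum_def int_optimum_def is_arg_min_def eq not_less)
  \<comment> \<open>The two difference vectors coincide, so their norms agree for any norm.\<close>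
  moreover have diff: "x_hat - real_vec z_star = x_star - real_vec z_hat" "x_star - real_vec z_hat = x - real_vec y"
    by (simp_all add: x_star_def z_star_def x_def real_vec_add)
  moreover have card: "real (card {i. x $ i \<noteq> 0}) \<le> real CARD('n)"
    by (simp add: card_mono)
  have "infnorm (x - real_vec y) \<le> real CARD('n) * graver_inf A"
    using bound[of infnorm "graver_inf A"] mult_right_mono[OF card graver_inf_nonneg[of A]]
    by (simp add: infnorm_triangle infnorm_mul graver_inf_nonneg graver_inf_ge)
  moreover have "l1norm (x - real_vec y) \<le> real CARD('n) * graver_l1 A"
    using bound[of l1norm "graver_l1 A"] mult_right_mono[OF card graver_l1_nonneg[of A]]
    by (simp add: l1norm_triangle l1norm_scaleR graver_l1_nonneg graver_l1_ge)
  ultimately show ?thesis by metis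
qed

end
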